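(* There exists a Borel probability measure $\mu$ on $[0,1]$, invariant with respect to the Gauss map $G$, which gives full measure to the set of Liouville numbers. In particular, $\mu$ is not extremal.
   Context: The Gauss map is $G:[0,1]\to[0,1]$, $G(x)=\frac1x-\lfloor 1/x\rfloor$ for $x>0$, and $G(0)=0$. A measure $\mu$ is invariant with respect to $G$ if $\mu\circ G^{-1}=\mu$. For $\psi:\mathbb{N}\to(0,\infty)$, an irrational $x\in[0,1]$ is $\psi$-approximable if there exist infinitely many rationals $p/q$ (in lowest terms, $q\ge 1$) such that $|x-p/q|\le\psi(q)$. An irrational $x$ is very well approximable if there exists $c>0$ such that $x$ is $\psi$-approximable for $\psi(q)=q^{-(2+c)}$. An irrational $x$ is a Liouville number if for all $c>0$ it is $\psi$-approximable for $\psi(q)=q^{-c}$. A measure is extremal if the set of very well approximable numbers is null for it. *)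

theory Defs
  imports "HOL-Probability.Probability"
begin

definition gauss_map :: "real \<Rightarrow> real" where
  "gauss_map x = (if x > 0 then 1 / x - of_int \<lfloor>1 / x\<rfloor> else 0)"

definition borel_prob_unit :: "real measure \<Rightarrow> bool" where
  "borel_prob_unit \<mu> \<longleftrightarrow>
     prob_space \<mu> \<and> sets \<mu> = sets (restrict_space borel {0..1})"

(* Measurability of T is required explicitly because distr is only the
   push-forward measure for measurable maps. *)
definition invariant_under :: "'a measure \<Rightarrow> ('a \<Rightarrow> 'a) \<Rightarrow> bool" where
  "invariant_under \<mu> T \<longleftrightarrow> T \<in> measurable \<mu> \<mu> \<and> distr \<mu> \<mu> T = \<mu>"

(* A rational is represented by its unique pair (p, q) in lowest terms with q \<ge> 1,
   so infinitely many pairs means infinitely many rationals.  The value of \<psi> at 0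
   is never used. *)
definition approximable :: "(nat \<Rightarrow> real) \<Rightarrow> real \<Rightarrow> bool" where
  "approximable \<psi> x \<longleftrightarrow> x \<in> {0..1} \<and> x \<notin> \<rat> \<and>
     infinite {(p :: int, q :: nat). q \<ge> 1 \<and> coprime p (int q) \<and>
                 \<bar>x - of_int p / of_nat q\<bar> \<le> \<psi> q}"

definition very_well_approximable :: "real set" where
  "very_well_approximable =
     {x \<in> {0..1}. x \<notin> \<rat> \<and> (\<exists>c>0. approximable (\<lambda>q. real q powr (- (2 + c))) x)}"

definition liouville_numbers :: "real set" where
  "liouville_numbers =
     {x \<in> {0..1}. x \<notin> \<rat> \<and> (\<forall>c>0. approximable (\<lambda>q. real q powr (- c)) x)}"

(* Null in the sense of being contained in a measurable set of measure zero. *)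
definition extremal :: "real measure \<Rightarrow> bool" where
  "extremal \<mu> \<longleftrightarrow> (AE x in \<mu>. x \<notin> very_well_approximable)"

end

theory Submission
  imports Defs "HOL-Real_Asymp.Real_Asymp"
begin

text \<open>
  Take a continued fraction whose digits are independent and identically distributed; its law is
  invariant because the Gauss map acts on digits as the shift. The digits are \<open>A (K n)\<close>, where
  \<open>P (K n \<ge> k) = 1 / (k + 1)\<close> and \<open>A\<close> grows so fast that \<open>A k\<close> is the \<open>k\<^sup>2\<close>-th power
  of \<open>A (k - 1) + 1\<close>. As the harmonic series diverges, almost surely \<open>K n \<ge> n\<close> infinitely often,
  hence also infinitely often at a strict record \<open>n\<close> of \<open>K\<close>. At such a record the
  digit \<open>A (K n)\<close> is at least the \<open>n\<close>-th power of the denominator of the convergent preceding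
  it, so the continued fraction is a Liouville number.
\<close>

section \<open>Continued fractions with digits at least 2\<close>

text \<open>The convergent built from the first \<open>n\<close> digits, with the remaining tail
  replaced by 0. Peeling off the first digit, rather than using the recurrences for numerators and
  denominators, makes the digit shift visible in the recursion.\<close>

primrec cf :: "nat \<Rightarrow> (nat \<Rightarrow> nat) \<Rightarrow> real" where
  "cf 0 a = 0"
| "cf (Suc n) a = 1 / (real (a 0) + cf n (\<lambda>i. a (Suc i)))"

definition cf_lim :: "(nat \<Rightarrow> nat) \<Rightarrow> real" where
  "cf_lim a = lim (\<lambda>n. cf n a)"

lemma cf_nonneg: "0 \<le> cf n a"
  by (induction n arbitrary: a) auto

lemma cf_le:
  assumes "a 0 \<ge> 1"
  shows "cf n a \<le> 1 / real (a 0)"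
proof (cases n)
  case (Suc m)
  then show ?thesis
    using assms cf_nonneg[of m "\<lambda>i. a (Suc i)"] by (auto intro!: divide_left_mono)
qed auto

text \<open>Prepending a digit d is the map y \<mapsto> 1/(d + y). For d \<ge> 2 and nonnegative
  arguments it contracts by 1/4, because both denominators are at least 2. After \<open>n\<close>
  digits are stripped, a convergent of the tail is compared with 0.\<close>

lemma cf_diff_le:
  assumes "\<And>i. a i \<ge> 2"
  shows "\<bar>cf (n + m) a - cf n a\<bar> \<le> (1/4) ^ n * cf m (\<lambda>i. a (n + i))"
  using assms
proof (induction n arbitrary: a)
  case 0
  then show ?case by (simp add: cf_nonneg)
next
  case (Suc n)
  let ?b = "\<lambda>i. a (Suc i)"
  define s t where "s = cf (n + m) ?b" and "t = cf n ?b"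
  have st: "s \<ge> 0" "t \<ge> 0" by (auto simp: s_def t_def cf_nonneg)
  have a0: "real (a 0) \<ge> 2" using Suc.prems[of 0] by simp
  have "(2::real) * 2 \<le> (real (a 0) + s) * (real (a 0) + t)"
    using a0 st by (intro mult_mono) auto
  moreover have "1 / (real (a 0) + s) - 1 / (real (a 0) + t)
      = (t - s) / ((real (a 0) + s) * (real (a 0) + t))"
    using a0 st by (simp add: field_simps)
  ultimately have "\<bar>1 / (real (a 0) + s) - 1 / (real (a 0) + t)\<bar> \<le> \<bar>t - s\<bar> / 4"
    using a0 st divide_left_mono[of 4 "(real (a 0) + s) * (real (a 0) + t)" "\<bar>t - s\<bar>"]
    by (simp add: abs_mult)
  also have "\<bar>t - s\<bar> \<le> (1/4) ^ n * cf m (\<lambda>i. ?b (n + i))"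
    using Suc.IH[of ?b] Suc.prems by (simp add: s_def t_def abs_minus_commute)
  finally show ?case by (simp add: s_def t_def)
qed

lemma cf_tendsto:
  assumes a: "\<And>i. a i \<ge> 2"
  shows "(\<lambda>n. cf n a) \<longlonglongrightarrow> cf_lim a"
proof -
  have "Cauchy (\<lambda>n. cf n a)"
  proof (rule CauchyI')
    fix e :: real assume "e > 0"
    then obtain N where N: "(1/4::real) ^ N < e"
      using real_arch_pow_inv[of e "1/4"] by auto
    have "dist (cf m a) (cf n a) < e" if "m \<ge> N" "n > m" for m n
    proof -
      have a_m: "a m \<ge> 2" by (rule a)
      have "cf (n - m) (\<lambda>i. a (m + i)) \<le> 1 / real (a m)"
        using cf_le[of "\<lambda>i. a (m + i)" "n - m"] a_m by simp
      also have "\<dots> \<le> 1" using a_m by simp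
      finally have "cf (n - m) (\<lambda>i. a (m + i)) \<le> 1" .
      then have "(1/4) ^ m * cf (n - m) (\<lambda>i. a (m + i)) \<le> (1/4) ^ m * 1"
        by (intro mult_left_mono) auto
      then have "\<bar>cf n a - cf m a\<bar> \<le> (1/4) ^ m * 1"
        using cf_diff_le[of a m "n - m", OF a] that by (auto intro: order_trans)
      also have "\<dots> \<le> (1/4) ^ N" using that by (simp add: power_decreasing)
      finally show ?thesis using N by (simp add: dist_real_def abs_minus_commute)
    qed
    then show "\<exists>M. \<forall>m\<ge>M. \<forall>n>m. dist (cf m a) (cf n a) < e" by blast
  qed
  then show ?thesis
    by (simp add: cf_lim_def Cauchy_convergent_iff convergent_LIMSEQ_iff)
qed

lemma cf_lim_nonneg:
  assumes "\<And>i. a i \<ge> 2"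
  shows "0 \<le> cf_lim a"
  by (rule LIMSEQ_le_const[OF cf_tendsto[of a, OF assms]]) (auto simp: cf_nonneg)

lemma cf_lim_rec:
  assumes a: "\<And>i. a i \<ge> 2"
  shows "cf_lim a = 1 / (real (a 0) + cf_lim (\<lambda>i. a (Suc i)))"
proof (rule LIMSEQ_unique)
  show "(\<lambda>n. cf (Suc n) a) \<longlonglongrightarrow> cf_lim a"
    using cf_tendsto[of a, OF a] by (rule LIMSEQ_Suc)
  have "real (a 0) + cf_lim (\<lambda>i. a (Suc i)) > 0"
    using cf_lim_nonneg[of "\<lambda>i. a (Suc i)", OF a] a[of 0] by (intro add_pos_nonneg) auto
  then show "(\<lambda>n. cf (Suc n) a) \<longlonglongrightarrow> 1 / (real (a 0) + cf_lim (\<lambda>i. a (Suc i)))"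
    using cf_tendsto[of "\<lambda>i. a (Suc i)"] a by (auto intro!: tendsto_intros)
qed

lemma cf_lim_bounds:
  assumes a: "\<And>i. a i \<ge> 2"
  shows "0 < cf_lim a" "cf_lim a \<le> 1 / real (a 0)" "cf_lim a < 1"
proof -
  have "cf_lim (\<lambda>i. a (Suc i)) \<ge> 0" "real (a 0) \<ge> 2"
    using cf_lim_nonneg[of "\<lambda>i. a (Suc i)"] a a[of 0] by auto
  then show "0 < cf_lim a" "cf_lim a \<le> 1 / real (a 0)" "cf_lim a < 1"
    using cf_lim_rec[of a, OF a] by (auto intro!: divide_left_mono)
qed

lemma gauss_map_cf_lim:
  assumes a: "\<And>i. a i \<ge> 2"
  shows "gauss_map (cf_lim a) = cf_lim (\<lambda>i. a (Suc i))"
proof -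
  let ?y = "cf_lim (\<lambda>i. a (Suc i))"
  have y: "0 < ?y" "?y < 1" using cf_lim_bounds[of "\<lambda>i. a (Suc i)"] a by auto
  have inv: "1 / cf_lim a = real (a 0) + ?y" using cf_lim_rec[of a, OF a] by simp
  have "\<lfloor>real (a 0) + ?y\<rfloor> = int (a 0)" using y by (simp add: floor_eq_iff)
  then show ?thesis using cf_lim_bounds(1)[of a, OF a] inv by (simp add: gauss_map_def)
qed

text \<open>The tail starting at digit \<open>n\<close> is at most \<open>1 / a n\<close>, and the
  contraction factor is simply bounded by 1. The usual denominators are not in the estimate, but a
  huge \<open>a n\<close> makes it strong enough.\<close>

lemma cf_lim_approx:
  assumes a: "\<And>i. a i \<ge> 2"
  shows "\<bar>cf_lim a - cf n a\<bar> \<le> 1 / real (a n)"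
proof -
  have "(\<lambda>m. cf (n + m) a) \<longlonglongrightarrow> cf_lim a"
    using LIMSEQ_ignore_initial_segment[OF cf_tendsto[of a, OF a], of n] by (simp add: add.commute)
  then have lim: "(\<lambda>m. \<bar>cf (n + m) a - cf n a\<bar>) \<longlonglongrightarrow> \<bar>cf_lim a - cf n a\<bar>"
    by (intro tendsto_intros)
  have "\<bar>cf (n + m) a - cf n a\<bar> \<le> 1 / real (a n)" for m
  proof -
    have "cf m (\<lambda>i. a (n + i)) \<le> 1 / real (a n)"
      using cf_le[of "\<lambda>i. a (n + i)" m] a[of n] by simp
    then have "(1/4) ^ n * cf m (\<lambda>i. a (n + i)) \<le> 1 * (1 / real (a n))"
      by (intro mult_mono) (auto simp: cf_nonneg power_le_one)
    then show ?thesis using cf_diff_le[of a n m] a by auto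
  qed
  then show ?thesis by (intro LIMSEQ_le_const2[OF lim]) auto
qed

text \<open>Inverting d + p/q gives q/(dq + p), which is again reduced. Carrying
  \<open>p \<le> q\<close> through the induction yields dq + p \<le> (d + 1)q, hence the product
  bound.\<close>

lemma cf_fraction:
  assumes "\<And>i. a i \<ge> 1"
  shows "\<exists>p q :: nat. q \<ge> 1 \<and> p \<le> q \<and> coprime p q \<and> cf n a = real p / real q
           \<and> q \<le> (\<Prod>i<n. a i + 1)"
  using assms
proof (induction n arbitrary: a)
  case 0
  show ?case by (rule exI[of _ 0], rule exI[of _ 1]) auto
next
  case (Suc n)
  obtain p q :: nat where pq: "q \<ge> 1" "p \<le> q" "coprime p q" "cf n (\<lambda>i. a (Suc i)) = real p / real q"
      "q \<le> (\<Prod>i<n. a (Suc i) + 1)"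
    using Suc.IH[of "\<lambda>i. a (Suc i)"] Suc.prems by blast
  have a0: "a 0 \<ge> 1" by (rule Suc.prems)
  have "a 0 * q + p \<le> (a 0 + 1) * q" using pq by (simp add: algebra_simps)
  also have "\<dots> \<le> (a 0 + 1) * (\<Prod>i<n. a (Suc i) + 1)" using pq by (intro mult_left_mono) auto
  also have "\<dots> = (\<Prod>i<Suc n. a i + 1)" by (simp only: prod.lessThan_Suc_shift)
  finally have bound: "a 0 * q + p \<le> (\<Prod>i<Suc n. a i + 1)" .
  have "real (a 0) + real p / real q = real (a 0 * q + p) / real q"
    using pq(1) by (simp add: field_simps)
  then have "cf (Suc n) a = real q / real (a 0 * q + p)"
    by (simp only: cf.simps pq(4)) simp
  moreover have "coprime q (a 0 * q + p)"
    using pq(3) by (metis coprime_commute coprime_iff_gcd_eq_1 gcd_add_mult mult.commute add.commute)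
  moreover have "q \<le> a 0 * q + p" using a0 by (cases "a 0") auto
  ultimately show ?case
    using pq bound by (intro exI[of _ q] exI[of _ "a 0 * q + p"]) auto
qed

text \<open>Descent: the Gauss map sends a fraction in \<open>(0, 1)\<close> to one with a smaller denominator.\<close>

lemma cf_lim_irrational:
  assumes a: "\<And>i. a i \<ge> 2"
  shows "cf_lim a \<notin> \<rat>"
proof -
  have no: "cf_lim a \<noteq> of_int p / of_int q" if "\<And>i. a i \<ge> 2" "p > 0" "q > 0" for p q :: int and a
    using that
  proof (induction "nat q" arbitrary: p q a rule: less_induct)
    case less
    let ?y = "cf_lim (\<lambda>i. a (Suc i))"
    show ?case
    proof
      assume eq: "cf_lim a = of_int p / of_int q"
      have "p < q" using cf_lim_bounds(3)[of a] less.prems eq by simp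
      have y: "?y > 0" using cf_lim_bounds(1)[of "\<lambda>i. a (Suc i)"] less.prems by auto
      have "1 / cf_lim a = real (a 0) + ?y" using cf_lim_rec[of a] less.prems by simp
      then have y_eq: "?y = of_int (q - int (a 0) * p) / of_int p"
        using eq less.prems by (simp add: field_simps)
      then have "q - int (a 0) * p > 0"
        using y less.prems by (metis of_int_0_less_iff zero_less_divide_iff order.asym)
      then show False
        using less.hyps[of p "\<lambda>i. a (Suc i)" "q - int (a 0) * p"] \<open>p < q\<close> less.prems y_eq by simp
    qed
  qed
  show ?thesis
  proof
    assume "cf_lim a \<in> \<rat>"
    then obtain p q :: int where pq: "q > 0" "cf_lim a = of_int p / of_int q"
      by (auto elim: Rats_cases')
    then have "p > 0" using cf_lim_bounds(1)[of a, OF a] by (simp add: zero_less_divide_iff)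
    then show False using no[of a p q, OF a] pq by blast
  qed
qed

text \<open>The product bounds the denominator q of the convergent before digit \<open>n\<close>, so
  at the given \<open>n\<close> the error is at most \<open>1 / a n\<close>, hence at most
  \<open>1 / q ^ n\<close>. These exponents exceed every fixed \<open>c\<close>.\<close>

lemma cf_lim_liouville:
  assumes a: "\<And>i. a i \<ge> 2"
    and large: "\<exists>\<^sub>\<infinity>n. (\<Prod>i<n. a i + 1) ^ n \<le> a n"
  shows "cf_lim a \<in> liouville_numbers"
proof -
  let ?x = "cf_lim a"
  have irr: "?x \<notin> \<rat>" and mem: "?x \<in> {0..1}"
    using cf_lim_irrational[of a] cf_lim_bounds[of a] a by (auto simp: less_imp_le)
  have "infinite {(p :: int, q :: nat). q \<ge> 1 \<and> coprime p (int q) \<and>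
                 \<bar>?x - of_int p / of_nat q\<bar> \<le> real q powr (- c)}" (is "infinite ?S") for c
  proof
    assume fin: "finite ?S"
    \<comment> \<open>If only finitely many fractions qualified, the irrational \<open>?x\<close>
      would stay at least \<open>d > 0\<close> away from all of them, while late convergents come
      closer and still qualify. Inserting 1 keeps the minimum over a nonempty set.\<close>
    define d where "d = Min (insert 1 ((\<lambda>(p, q). \<bar>?x - of_int p / of_nat q\<bar>) ` ?S))"
    have "\<bar>?x - of_int p / of_nat q\<bar> > 0" for p :: int and q :: nat
      using irr Rats_divide[OF Rats_of_int[of p] Rats_of_nat[of q]] by auto
    then have "d > 0" using fin by (auto simp: d_def)
    have d_le: "d \<le> \<bar>?x - of_int p / of_nat q\<bar>" if "(p, q) \<in> ?S" for p q
      unfolding d_def using fin that by (intro Min_le) force+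
    have "eventually (\<lambda>n. \<bar>?x - cf n a\<bar> < d) sequentially"
      using tendstoD[OF cf_tendsto[of a, OF a] \<open>d > 0\<close>] by (simp add: dist_real_def abs_minus_commute)
    moreover have "eventually (\<lambda>n. real n \<ge> c) sequentially"
      by real_asymp
    ultimately have "eventually (\<lambda>n. \<bar>?x - cf n a\<bar> < d \<and> real n \<ge> c) sequentially"
      by (rule eventually_conj)
    then obtain N where "\<And>n. n \<ge> N \<Longrightarrow> \<bar>?x - cf n a\<bar> < d \<and> real n \<ge> c"
      by (auto simp: eventually_sequentially)
    then obtain n where n: "(\<Prod>i<n. a i + 1) ^ n \<le> a n" "\<bar>?x - cf n a\<bar> < d" "real n \<ge> c"
      using large unfolding INFM_nat_le by blast
    obtain p q :: nat where pq: "q \<ge> 1" "coprime p q" "cf n a = real p / real q"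
        "q \<le> (\<Prod>i<n. a i + 1)"
      using cf_fraction[of a n] a by (meson le_trans one_le_numeral)
    have "q ^ n \<le> a n" using power_mono[OF pq(4), of n] n(1) by simp
    then have "real q ^ n \<le> real (a n)" by (metis of_nat_le_iff of_nat_power)
    have "\<bar>?x - cf n a\<bar> \<le> 1 / real (a n)" by (rule cf_lim_approx[of a n, OF a])
    also have "\<dots> \<le> 1 / real q ^ n"
      using \<open>real q ^ n \<le> real (a n)\<close> pq(1) a[of n] by (intro divide_left_mono) auto
    also have "\<dots> = real q powr (- real n)"
      using pq(1) by (simp add: powr_minus powr_realpow divide_inverse)
    also have "\<dots> \<le> real q powr (- c)" using pq(1) n(3) by (intro powr_mono) auto
    finally have "(int p, q) \<in> ?S" using pq by simp
    then show False using d_le[of "int p" q] n(2) pq(3) by simp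
  qed
  then show ?thesis using irr mem by (auto simp: liouville_numbers_def approximable_def)
qed

section \<open>Fast growing digits at record times\<close>

text \<open>In the exponent one factor \<open>Suc k\<close> pays for the number of digits before a
  record, the other for the power \<open>n\<close> demanded there.\<close>

primrec digit :: "nat \<Rightarrow> nat" where
  "digit 0 = 2"
| "digit (Suc k) = (digit k + 1) ^ (Suc k * Suc k)"

lemma digit_Suc_gt: "digit k < digit (Suc k)"
proof -
  have "(digit k + 1) ^ 1 \<le> (digit k + 1) ^ (Suc k * Suc k)"
    by (rule power_increasing) simp_all
  then show ?thesis by (simp only: digit.simps power_one_right)
qed

lemma digit_mono: "k \<le> l \<Longrightarrow> digit k \<le> digit l"
  by (rule lift_Suc_mono_le[of digit]) (use digit_Suc_gt in \<open>auto intro: less_imp_le\<close>)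

lemma digit_ge_2: "digit k \<ge> 2"
  using digit_mono[of 0 k] by simp

lemma infinitely_many_records:
  fixes w :: "nat \<Rightarrow> nat"
  assumes "\<exists>\<^sub>\<infinity>n. n \<le> w n"
  shows "\<exists>\<^sub>\<infinity>n. n \<le> w n \<and> (\<forall>i<n. w i < w n)"
  unfolding INFM_nat_le
proof
  fix N
  define B where "B = Suc (Max (insert 0 (w ` {..<N})))"
  have B: "w i < B" if "i < N" for i
    using that by (auto simp: B_def less_Suc_eq_le intro!: Max_ge)
  obtain m where m: "m \<ge> B" "m \<le> w m" using assms by (auto simp: INFM_nat_le)
  \<comment> \<open>The first time the value \<open>w m\<close> is reached is a strict record. It is
    not after \<open>m\<close>, so \<open>n \<le> m \<le> w m \<le> w n\<close>; it is not before
    \<open>N\<close>, since values there are below \<open>B \<le> m \<le> w m\<close>.\<close>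
  define n where "n = (LEAST i. w i \<ge> w m)"
  have n: "w n \<ge> w m" "n \<le> m"
    unfolding n_def by (rule LeastI[of _ m] Least_le, simp)+
  have lt: "w i < w m" if "i < n" for i
    using not_less_Least[of i "\<lambda>i. w i \<ge> w m"] that by (simp add: n_def)
  have "N \<le> n" using B[of n] m n by linarith
  moreover have "n \<le> w n" using m n by linarith
  moreover have "\<forall>i<n. w i < w n" using lt n by (meson less_le_trans)
  ultimately show "\<exists>n\<ge>N. n \<le> w n \<and> (\<forall>i<n. w i < w n)" by blast
qed

text \<open>At a strict record with \<open>w n = Suc k\<close> all earlier indices are at most
  \<open>k\<close>, so the left side is at most \<open>(digit k + 1) ^ (n * n)\<close>, and
  \<open>n \<le> Suc k\<close>.\<close>

lemma digit_record:
  assumes n: "n \<le> w n" "\<And>i. i < n \<Longrightarrow> w i < w n" and "n > 0"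
  shows "(\<Prod>i<n. digit (w i) + 1) ^ n \<le> digit (w n)"
proof -
  obtain k where k: "w n = Suc k" using assms by (cases "w n") auto
  have "(\<Prod>i<n. digit (w i) + 1) \<le> (\<Prod>i<n. digit k + 1)"
    using n k by (intro prod_mono) (auto intro!: digit_mono simp: less_Suc_eq_le)
  then have "(\<Prod>i<n. digit (w i) + 1) ^ n \<le> ((digit k + 1) ^ n) ^ n"
    by (intro power_mono) auto
  also have "\<dots> = (digit k + 1) ^ (n * n)" by (simp only: power_mult)
  also have "\<dots> \<le> (digit k + 1) ^ (Suc k * Suc k)"
    using n k by (intro power_increasing mult_mono) auto
  finally show ?thesis using k by simp
qed

lemma cf_lim_digit_liouville:
  assumes "\<exists>\<^sub>\<infinity>n. n \<le> w n"
  shows "cf_lim (\<lambda>i. digit (w i)) \<in> liouville_numbers"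
proof (rule cf_lim_liouville)
  have "\<exists>\<^sub>\<infinity>n. (n \<le> w n \<and> (\<forall>i<n. w i < w n)) \<and> n > 0"
    using infinitely_many_records[OF assms] by (fastforce simp: INFM_nat)
  then show "\<exists>\<^sub>\<infinity>n. (\<Prod>i<n. digit (w i) + 1) ^ n \<le> digit (w n)"
    by (rule INFM_mono) (use digit_record[of _ w] in blast)
qed (rule digit_ge_2)

section \<open>The law of the indices\<close>

text \<open>The weights are the differences 1/(k+1) - 1/(k+2), so the tails are exactly 1/(k+1),
  which is not summable.\<close>

definition heavy_pmf :: "nat pmf" where
  "heavy_pmf = embed_pmf (\<lambda>k. 1 / (real (k + 1) * real (k + 2)))"

lemma heavy_partial_sum: "(\<Sum>i<k. 1 / (real (i + 1) * real (i + 2))) = real k / real (k + 1)"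
proof (induction k)
  case (Suc k)
  have "real k / real (k + 1) + 1 / (real (k + 1) * real (k + 2)) = real (Suc k) / real (Suc k + 1)"
    by (simp add: divide_simps) (simp add: algebra_simps)
  with Suc show ?case by simp
qed simp

lemma pmf_heavy: "pmf heavy_pmf k = 1 / (real (k + 1) * real (k + 2))"
  unfolding heavy_pmf_def
proof (rule pmf_embed_pmf)
  have "(\<lambda>k. real k / real (k + 1)) \<longlonglongrightarrow> 1"
    by real_asymp
  then have "(\<lambda>k. 1 / (real (k + 1) * real (k + 2))) sums 1"
    by (simp only: sums_def heavy_partial_sum)
  then have "(\<Sum>k. ennreal (1 / (real (k + 1) * real (k + 2)))) = ennreal 1"
    by (intro suminf_ennreal_eq) auto
  then show "(\<integral>\<^sup>+ k. ennreal (1 / (real (k + 1) * real (k + 2))) \<partial>count_space UNIV) = 1"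
    by (simp only: nn_integral_count_space_nat ennreal_1)
qed auto

lemma emeasure_heavy_lessThan: "emeasure heavy_pmf {..<k} = ennreal (real k / real (k + 1))"
  using heavy_partial_sum[of k]
  by (simp add: measure_pmf.emeasure_eq_measure measure_measure_pmf_finite pmf_heavy)

abbreviation index_space :: "(nat \<Rightarrow> nat) measure" where
  "index_space \<equiv> PiM UNIV (\<lambda>_. measure_pmf heavy_pmf)"

interpretation index: product_prob_space "\<lambda>_. measure_pmf heavy_pmf" "UNIV :: nat set"
  by unfold_locales

text \<open>The factors are the probabilities of an index below \<open>i\<close>; the product tends
  to 0 as \<open>m\<close> grows.\<close>

lemma prod_telescope:
  assumes "N > 0"
  shows "(\<Prod>i=N..<N + m. real i / real (i + 1)) = real N / real (N + m)"
  using assms by (induction m) (auto simp: field_simps)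

text \<open>The second Borel-Cantelli lemma, in a case where the products telescope.\<close>

lemma AE_index_infinitely_often: "AE w in index_space. \<exists>\<^sub>\<infinity>n. n \<le> w n"
proof -
  have "AE w in index_space. \<exists>n\<ge>N. n \<le> w n" if "N > 0" for N
  proof -
    let ?X = "{w \<in> space index_space. \<not> (\<exists>n\<ge>N. n \<le> w n)}"
    let ?Y = "\<lambda>m. {w \<in> space index_space. \<forall>n\<in>{N..<N+m}. w n \<in> {..<n}}"
    have meas: "?X \<in> sets index_space" by measurable
    have le: "emeasure index_space ?X \<le> ennreal (real N / real (N + m))" for m
    proof -
      \<comment> \<open>The event that no \<open>n \<ge> N\<close> has \<open>n \<le> w n\<close> is
        enlarged to finitely many coordinates, where independence turns its measure into a
        product.\<close>
      have "emeasure index_space ?X \<le> emeasure index_space (?Y m)"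
        by (rule emeasure_mono) (clarsimp, meson not_le, simp)
      also have "\<dots> = (\<Prod>n\<in>{N..<N+m}. emeasure heavy_pmf {..<n})"
        by (rule index.emeasure_PiM_Collect) auto
      also have "\<dots> = ennreal (\<Prod>n\<in>{N..<N+m}. real n / real (n + 1))"
        by (simp only: emeasure_heavy_lessThan) (rule prod_ennreal, simp)
      finally show ?thesis by (simp only: prod_telescope[OF that])
    qed
    have "(\<lambda>m. ennreal (real N / real (N + m))) \<longlonglongrightarrow> ennreal 0"
      by (intro tendsto_ennrealI) real_asymp
    then have "emeasure index_space ?X \<le> ennreal 0"
      by (rule LIMSEQ_le_const) (use le in auto)
    then have "?X \<in> null_sets index_space" using meas by auto
    then show ?thesis by (rule AE_I') (rule subset_refl)
  qed
  then have "AE w in index_space. \<forall>N. \<exists>n\<ge>Suc N. n \<le> w n"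
    by (auto simp: AE_all_countable)
  then show ?thesis
    by eventually_elim (auto simp: INFM_nat Suc_le_eq)
qed

lemma measurable_seq_shift [measurable]: "(\<lambda>w i. w (Suc i)) \<in> measurable index_space index_space"
  by (rule measurable_PiM_single') (auto simp: space_PiM)

text \<open>The shift reindexes the coordinates along the injection \<open>Suc\<close>, and all
  factors of the product measure are equal.\<close>

lemma distr_shift: "distr index_space index_space (\<lambda>w i. w (Suc i)) = index_space"
  using distr_PiM_reindex[of UNIV "\<lambda>_. measure_pmf heavy_pmf" Suc UNIV]
  by (simp add: prob_space_measure_pmf restrict_UNIV)

section \<open>The invariant measure\<close>

abbreviation unit_borel :: "real measure" where
  "unit_borel \<equiv> restrict_space borel {0..1}"

abbreviation cf_index :: "(nat \<Rightarrow> nat) \<Rightarrow> real" where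
  "cf_index w \<equiv> cf_lim (\<lambda>i. digit (w i))"

lemma measurable_cf_digit: "(\<lambda>w. cf n (\<lambda>i. digit (w i))) \<in> borel_measurable index_space"
proof (induction n)
  case (Suc n)
  from measurable_compose[OF measurable_seq_shift Suc]
  have [measurable]: "(\<lambda>w. cf n (\<lambda>i. digit (w (Suc i)))) \<in> borel_measurable index_space" .
  have [measurable]: "(\<lambda>w. real (digit (w 0))) \<in> borel_measurable index_space"
    by (rule measurable_compose[OF measurable_component_singleton]) auto
  show ?case by simp
qed simp

lemma measurable_cf_index [measurable]: "cf_index \<in> measurable index_space unit_borel"
proof (rule measurable_restrict_space2)
  show "cf_index \<in> borel_measurable index_space"
    unfolding cf_lim_def by (rule borel_measurable_lim_metric) (rule measurable_cf_digit)
  show "cf_index \<in> space index_space \<rightarrow> {0..1}"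
    using cf_lim_bounds[of "\<lambda>i. digit (_ i)"] digit_ge_2 by (auto simp: less_imp_le)
qed

lemma measurable_gauss_map: "gauss_map \<in> measurable unit_borel unit_borel"
proof (rule measurable_restrict_space3)
  show "gauss_map \<in> borel_measurable borel" unfolding gauss_map_def by measurable
  show "gauss_map \<in> {0..1} \<rightarrow> {0..1}"
    by (auto simp: gauss_map_def frac_def[symmetric] frac_lt_1[THEN less_imp_le])
qed

text \<open>Rewrites membership with countable quantifiers only, as measurability requires. Natural
  exponents suffice because the sets of approximants shrink as the exponent grows, and infinitude
  becomes unboundedness of the codes \<open>to_nat\<close>.\<close>

lemma liouville_iff_nat:
  "x \<in> liouville_numbers \<longleftrightarrow> x \<in> {0..1} \<and> x \<notin> \<rat> \<and>
     (\<forall>c m :: nat. \<exists>z :: int \<times> nat. to_nat z > m \<and> snd z \<ge> 1 \<and> coprime (fst z) (int (snd z)) \<and>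
        \<bar>x - of_int (fst z) / of_nat (snd z)\<bar> \<le> real (snd z) powr (- real c))"
proof -
  let ?S = "\<lambda>c. {(p :: int, q :: nat). q \<ge> 1 \<and> coprime p (int q) \<and>
                 \<bar>x - of_int p / of_nat q\<bar> \<le> real q powr (- c)}"
  have mono: "?S d \<subseteq> ?S c" if "c \<le> d" for c d
  proof -
    have "real q powr - d \<le> real q powr - c" if "q \<ge> 1" for q :: nat
      using that \<open>c \<le> d\<close> by (intro powr_mono) auto
    then show ?thesis by (auto intro: order_trans)
  qed
  have "(\<forall>c>0. infinite (?S c)) \<longleftrightarrow> (\<forall>c::nat. infinite (?S (real c)))"
  proof safe
    fix c :: nat assume inf: "\<forall>c>0. infinite (?S c)" and fin: "finite (?S (real c))"
    have "finite (?S (real c + 1))" by (rule finite_subset[OF mono fin]) simp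
    then show False using inf[rule_format, of "real c + 1"] by simp
  next
    fix c :: real assume *: "\<forall>c::nat. infinite (?S (real c))" "finite (?S c)"
    obtain n where "c \<le> real n" using real_arch_simple by blast
    then show False using finite_subset[OF mono[of c "real n"]] * by blast
  qed
  also have "\<dots> \<longleftrightarrow> (\<forall>c::nat. infinite (to_nat ` ?S (real c)))"
    by (simp add: finite_image_iff inj_on_subset[OF inj_to_nat])
  also have "\<dots> \<longleftrightarrow> (\<forall>c m :: nat. \<exists>z. to_nat z > m \<and> z \<in> ?S (real c))"
    unfolding infinite_nat_iff_unbounded by blast
  finally show ?thesis
    by (auto simp: liouville_numbers_def approximable_def case_prod_unfold)
qed

lemma sets_liouville: "liouville_numbers \<in> sets unit_borel"
proof -
  have "Measurable.pred borel (\<lambda>x::real. x \<notin> \<rat>)"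
    using borel_closed sets.countable[of \<rat> borel] countable_rat
    by (intro pred_intros_logic) (auto simp: pred_def)
  then have "{x \<in> space borel. x \<in> liouville_numbers} \<in> sets borel"
    unfolding liouville_iff_nat by measurable
  then show ?thesis by (auto simp: sets_restrict_space_iff liouville_numbers_def)
qed

lemma liouville_imp_very_well_approximable: "liouville_numbers \<subseteq> very_well_approximable"
proof
  fix x assume x: "x \<in> liouville_numbers"
  then have "approximable (\<lambda>q. real q powr (- (2 + 1))) x"
    unfolding liouville_numbers_def by fastforce
  with x show "x \<in> very_well_approximable"
    unfolding liouville_numbers_def very_well_approximable_def by (auto intro: exI[of _ "1::real"])
qed

theorem theorem4p5:
  shows "\<exists>\<mu> :: real measure. borel_prob_unit \<mu> \<and> invariant_under \<mu> gauss_map \<and>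
           emeasure \<mu> liouville_numbers = 1 \<and> \<not> extremal \<mu>"
proof -
  define \<mu> where "\<mu> = distr index_space unit_borel cf_index"
  have sets: "sets \<mu> = sets unit_borel" by (simp add: \<mu>_def)
  interpret prob_space \<mu>
    unfolding \<mu>_def by (rule index.prob_space_distr) (rule measurable_cf_index)
  have G: "gauss_map \<in> measurable \<mu> \<mu>"
    using measurable_gauss_map by (simp add: measurable_cong_sets[OF sets sets])
  have "distr \<mu> \<mu> gauss_map = distr \<mu> unit_borel gauss_map"
    by (rule distr_cong) (auto simp: sets)
  also have "\<dots> = distr index_space unit_borel (gauss_map \<circ> cf_index)"
    unfolding \<mu>_def by (rule distr_distr[OF measurable_gauss_map measurable_cf_index])
  \<comment> \<open>The semiconjugacy: the Gauss map deletes the first digit, so invariance of the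
    law follows from shift invariance of the product measure.\<close>
  also have "gauss_map \<circ> cf_index = cf_index \<circ> (\<lambda>w i. w (Suc i))"
    by (simp add: fun_eq_iff gauss_map_cf_lim digit_ge_2)
  also have "distr index_space unit_borel \<dots>
      = distr (distr index_space index_space (\<lambda>w i. w (Suc i))) unit_borel cf_index"
    by (rule distr_distr[OF measurable_cf_index measurable_seq_shift, symmetric])
  also have "\<dots> = \<mu>" by (simp only: distr_shift \<mu>_def)
  finally have inv: "invariant_under \<mu> gauss_map" using G by (simp add: invariant_under_def)
  have "AE w in index_space. cf_index w \<in> liouville_numbers"
    using AE_index_infinitely_often by eventually_elim (rule cf_lim_digit_liouville)
  moreover have "{x \<in> space unit_borel. x \<in> liouville_numbers} = liouville_numbers"
    by (auto simp: space_restrict_space liouville_numbers_def)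
  ultimately have ae: "AE x in \<mu>. x \<in> liouville_numbers"
    unfolding \<mu>_def using sets_liouville
    by (subst AE_distr_iff[OF measurable_cf_index]) simp_all
  have "\<not> extremal \<mu>"
  proof
    assume "extremal \<mu>"
    \<comment> \<open>Almost every point would be both Liouville and not very well approximable,
      which is impossible in a probability space.\<close>
    then have "AE x in \<mu>. False"
      using ae unfolding extremal_def
      by eventually_elim (use liouville_imp_very_well_approximable in blast)
    then show False by simp
  qed
  moreover have "emeasure \<mu> liouville_numbers = 1"
    using ae sets_liouville sets by (simp add: emeasure_eq_1_AE)
  moreover have "borel_prob_unit \<mu>"
    using sets prob_space_axioms by (simp add: borel_prob_unit_def)
  ultimately show ?thesis using inv by blast
qed

end
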